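(* Let $n\ge 2$, $k\ge 1$, and let $\Phi:\mathbb{M}(n)\to\mathbb{M}(k)$ be a positive unital linear map. Let $A=(a_{ij})\in\mathbb{M}(n)$ be a nonnegative symmetric matrix, and let $b_{11}$ and $b_{22}$ denote respectively the first and the second smallest of the diagonal entries $a_{11},\dots,a_{nn}$. Then $$\rho(A)\,I_k\ \ge\ \frac{b_{11}+b_{22}}{2}\,I_k+\left(\Phi(A^2)-\Phi(A)^2\right)^{1/2}.$$
   Context: $\mathbb{M}(n)$ is the algebra of all $n\times n$ complex matrices and $I_k$ is the $k\times k$ identity matrix. A matrix $A=(a_{ij})$ is nonnegative if $a_{ij}\ge0$ for all $i,j$ (entrywise). $\rho(A)=\max\{|\lambda|:\lambda\in\sigma(A)\}$ is the spectral radius, where $\sigma(A)$ is the spectrum of $A$. A linear map $\Phi:\mathbb{M}(n)\to\mathbb{M}(k)$ is positive if $\Phi(M)$ is positive semidefinite whenever $M$ is positive semidefinite, and unital if $\Phi(I_n)=I_k$. For Hermitian $k\times k$ matrices, $P\ge Q$ means that $P-Q$ is positive semidefinite. For $A$ Hermitian, $\Phi(A^2)-\Phi(A)^2$ is positive semidefinite (Kadison's inequality), and $(\cdot)^{1/2}$ denotes the positive semidefinite square root. The smallest diagonal entries are counted with multiplicity. *)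

theory Defs
  imports
    "Jordan_Normal_Form.Spectral_Radius"
    "Jordan_Normal_Form.Schur_Decomposition"
    "Jordan_Normal_Form.VS_Connect"
begin

definition hermitian_mat :: "complex mat \<Rightarrow> bool" where
  "hermitian_mat A \<longleftrightarrow> mat_adjoint A = A"

(* The order on complex is that of Complex_Order: 0 \<le> z means that z is real and nonnegative. *)
definition psd :: "nat \<Rightarrow> complex mat \<Rightarrow> bool" where
  "psd n A \<longleftrightarrow> A \<in> carrier_mat n n \<and> hermitian_mat A \<and>
     (\<forall>v \<in> carrier_vec n. 0 \<le> (A *\<^sub>v v) \<bullet>c v)"

(* The Loewner order on Hermitian matrices; the library's \<le> on matrices is the entrywise order. *)
definition loewner_ge :: "nat \<Rightarrow> complex mat \<Rightarrow> complex mat \<Rightarrow> bool" where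
  "loewner_ge k P Q \<longleftrightarrow>
     P \<in> carrier_mat k k \<and> hermitian_mat P \<and>
     Q \<in> carrier_mat k k \<and> hermitian_mat Q \<and> psd k (P - Q)"

(* Meaningful for positive semidefinite S only, where such a B exists and is unique. *)
definition psd_sqrt :: "nat \<Rightarrow> complex mat \<Rightarrow> complex mat" where
  "psd_sqrt k S = (THE B. psd k B \<and> B ^\<^sub>m 2 = S)"

definition nonneg_mat :: "complex mat \<Rightarrow> bool" where
  "nonneg_mat A \<longleftrightarrow> (\<forall>i < dim_row A. \<forall>j < dim_col A. 0 \<le> A $$ (i, j))"

lemma linear_map_mat_iff:
  "linear_map class_ring (module_mat TYPE(complex) n n) (module_mat TYPE(complex) k k) \<Phi> \<longleftrightarrow>
     (\<forall>X \<in> carrier_mat n n. \<Phi> X \<in> carrier_mat k k) \<and>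
     (\<forall>X \<in> carrier_mat n n. \<forall>Y \<in> carrier_mat n n. \<Phi> (X + Y) = \<Phi> X + \<Phi> Y) \<and>
     (\<forall>c. \<forall>X \<in> carrier_mat n n. \<Phi> (c \<cdot>\<^sub>m X) = c \<cdot>\<^sub>m \<Phi> X)"
  using matrix_vs[where 'a = complex, of n n] matrix_vs[where 'a = complex, of k k]
  unfolding linear_map_def mod_hom_def mod_hom_axioms_def
    LinearCombinations.module_hom_def vectorspace_def
  by (auto simp: module_mat_def)

definition positive_mat_map :: "nat \<Rightarrow> nat \<Rightarrow> (complex mat \<Rightarrow> complex mat) \<Rightarrow> bool" where
  "positive_mat_map n k \<Phi> \<longleftrightarrow> (\<forall>M. psd n M \<longrightarrow> psd k (\<Phi> M))"

definition unital_mat_map :: "nat \<Rightarrow> nat \<Rightarrow> (complex mat \<Rightarrow> complex mat) \<Rightarrow> bool" where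
  "unital_mat_map n k \<Phi> \<longleftrightarrow> \<Phi> (1\<^sub>m n) = 1\<^sub>m k"

(* The diagonal in nondecreasing order with multiplicity: indices 0 and 1 give its smallest and
   second smallest entries. Intended for matrices with real diagonal. *)
definition sorted_diag :: "complex mat \<Rightarrow> real list" where
  "sorted_diag A = sort (map Re (diag_mat A))"

end

theory Submission
  imports Defs "HOL-Combinatorics.List_Permutation"
begin

text \<open>
  Let \<open>\<rho>\<close> be the spectral radius of \<open>A\<close> and \<open>m\<close> its smallest eigenvalue, so that the spectrum of
  \<open>A\<close> lies in \<open>[m, \<rho>]\<close>. The claim splits into an operator-theoretic half and a combinatorial half.

  The operator half is that the ``variance'' \<open>\<Phi>(A\<^sup>2) - \<Phi>(A)\<^sup>2\<close> lies between \<open>0\<close>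
  (\<open>kadison_inequality\<close>) and \<open>((\<rho> - m)/2)\<^sup>2\<close> (\<open>variance_bound\<close>). The upper bound comes from \<open>(\<rho> - A)(A - m) \<ge> 0\<close>: applying \<open>\<Phi>\<close> gives
  \<open>\<Phi>(A\<^sup>2) \<le> (\<rho> + m) \<Phi>(A) - \<rho> m\<close>, and completing the square in \<open>\<Phi>(A)\<close> finishes the estimate. Hence
  the square root of the variance is at most \<open>(\<rho> - m)/2\<close>.

  The combinatorial half is \<open>b\<^sub>1\<^sub>1 + b\<^sub>2\<^sub>2 \<le> \<rho> + m\<close>; the two halves together give
  \<open>\<rho> - (b\<^sub>1\<^sub>1 + b\<^sub>2\<^sub>2)/2 \<ge> (\<rho> - m)/2\<close>, which is the assertion. For the inequality
  (\<open>two_diagonal_entries_le_eigenvalue_sum\<close>), take a real eigenvector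
  \<open>v\<close> of \<open>m\<close> and split it as \<open>v = p - q\<close> into its positive and negative parts. If both are nonzero,
  the compression of \<open>A\<close> to the plane spanned by \<open>p\<close> and \<open>q\<close> has \<open>m\<close> as one eigenvalue and the other is at
  most \<open>\<rho>\<close>, so its trace, the sum of the Rayleigh quotients of \<open>p\<close> and \<open>q\<close>, is at most \<open>\<rho> + m\<close>.
  Since \<open>A\<close> is entrywise nonnegative, each Rayleigh quotient is at least some diagonal entry taken
  over the support of the vector, and the two supports are disjoint. If \<open>v\<close> has one sign only, then
  \<open>m\<close> itself dominates a diagonal entry, and \<open>\<rho>\<close> dominates all of them.

  The operator half, and the very existence and uniqueness of the square root, rest on the spectral
  theorem for Hermitian matrices (\<open>spectral_theorem\<close>), proved by deflation. Everything is then computed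
  in the form \<open>U f(D) U\<^sup>*\<close>, where positivity can be read off from the entries of \<open>f(D)\<close>.
\<close>

section \<open>Adjoints and the complex inner product\<close>

lemma mat_adjoint_index [simp]:
  "i < dim_col A \<Longrightarrow> j < dim_row A \<Longrightarrow> mat_adjoint A $$ (i, j) = cnj (A $$ (j, i))"
  by (simp add: mat_adjoint_def mat_of_rows_index)

lemma mat_adjoint_dim [simp]:
  "dim_row (mat_adjoint A) = dim_col A" "dim_col (mat_adjoint A) = dim_row A"
  by (simp_all add: mat_adjoint_def)

lemma mat_adjoint_carrier [simp]: "A \<in> carrier_mat n m \<Longrightarrow> mat_adjoint A \<in> carrier_mat m n"
  by auto

lemma mat_adjoint_adjoint [simp]: "mat_adjoint (mat_adjoint A) = (A :: complex mat)"
  by (rule eq_matI) auto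

lemma mult_square_mat [simp]:
  "A \<in> carrier_mat n n \<Longrightarrow> B \<in> carrier_mat n n \<Longrightarrow> A * B \<in> carrier_mat n n"
  by (rule mult_carrier_mat)

lemma assoc_square_mat:
  "A \<in> carrier_mat n n \<Longrightarrow> B \<in> carrier_mat n n \<Longrightarrow> C \<in> carrier_mat n n \<Longrightarrow>
    A * B * C = A * (B * (C :: complex mat))"
  by (rule assoc_mult_mat)

lemma mat_adjoint_mult:
  fixes A B :: "complex mat"
  assumes "A \<in> carrier_mat n m" "B \<in> carrier_mat m l"
  shows "mat_adjoint (A * B) = mat_adjoint B * mat_adjoint A"
  using assms by (intro eq_matI) (auto simp: scalar_prod_def mult.commute)

lemma cscalar_prod_sum:
  "v \<in> carrier_vec n \<Longrightarrow> w \<in> carrier_vec n \<Longrightarrow>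
    v \<bullet>c w = (\<Sum>i<n. v $ i * cnj (w $ i))"
  by (auto simp: scalar_prod_def lessThan_atLeast0 intro!: sum.cong)

lemma cscalar_prod_minus_left:
  fixes u v w :: "complex vec"
  shows "u \<in> carrier_vec n \<Longrightarrow> v \<in> carrier_vec n \<Longrightarrow> w \<in> carrier_vec n \<Longrightarrow>
    (u - v) \<bullet>c w = u \<bullet>c w - v \<bullet>c w"
  by (simp add: cscalar_prod_sum[of _ n] sum_subtractf[symmetric] algebra_simps)

lemma cscalar_prod_minus_right:
  fixes u v w :: "complex vec"
  shows "u \<in> carrier_vec n \<Longrightarrow> v \<in> carrier_vec n \<Longrightarrow> w \<in> carrier_vec n \<Longrightarrow>
    w \<bullet>c (u - v) = w \<bullet>c u - w \<bullet>c v"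
  by (simp add: cscalar_prod_sum[of _ n] sum_subtractf[symmetric] algebra_simps)

lemma cscalar_prod_add_left:
  fixes u v w :: "complex vec"
  shows "u \<in> carrier_vec n \<Longrightarrow> v \<in> carrier_vec n \<Longrightarrow> w \<in> carrier_vec n \<Longrightarrow>
    (u + v) \<bullet>c w = u \<bullet>c w + v \<bullet>c w"
  by (simp add: cscalar_prod_sum[of _ n] sum.distrib distrib_right)

lemma cscalar_prod_smult_left:
  fixes v w :: "complex vec"
  shows "v \<in> carrier_vec n \<Longrightarrow> w \<in> carrier_vec n \<Longrightarrow> (c \<cdot>\<^sub>v v) \<bullet>c w = c * (v \<bullet>c w)"
  by (simp add: cscalar_prod_sum[of _ n] sum_distrib_left mult_ac)

lemma cscalar_prod_smult_right:
  fixes v w :: "complex vec"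
  shows "v \<in> carrier_vec n \<Longrightarrow> w \<in> carrier_vec n \<Longrightarrow> v \<bullet>c (c \<cdot>\<^sub>v w) = cnj c * (v \<bullet>c w)"
  by (simp add: cscalar_prod_sum[of _ n] sum_distrib_left mult_ac)

lemma cscalar_prod_self:
  "v \<in> carrier_vec n \<Longrightarrow> v \<bullet>c v = complex_of_real (\<Sum>i<n. (cmod (v $ i))\<^sup>2)"
  by (simp add: cscalar_prod_sum complex_norm_square del: of_real_power)

lemma cscalar_prod_adjoint:
  fixes A :: "complex mat"
  assumes "A \<in> carrier_mat n m" "v \<in> carrier_vec m" "w \<in> carrier_vec n"
  shows "(A *\<^sub>v v) \<bullet>c w = v \<bullet>c (mat_adjoint A *\<^sub>v w)"
proof -
  have "(A *\<^sub>v v) \<bullet>c w = (\<Sum>i<n. \<Sum>j<m. A $$ (i, j) * v $ j * cnj (w $ i))"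
    using assms by (simp add: cscalar_prod_sum[of _ n] scalar_prod_def lessThan_atLeast0 sum_distrib_right)
  also have "\<dots> = (\<Sum>j<m. \<Sum>i<n. A $$ (i, j) * v $ j * cnj (w $ i))"
    by (rule sum.swap)
  also have "\<dots> = v \<bullet>c (mat_adjoint A *\<^sub>v w)"
    using assms by (simp add: cscalar_prod_sum[of _ m] scalar_prod_def lessThan_atLeast0
        sum_distrib_left algebra_simps)
  finally show ?thesis .
qed

lemma hermitian_cscalar_prod:
  assumes "A \<in> carrier_mat n n" "hermitian_mat A" "v \<in> carrier_vec n" "w \<in> carrier_vec n"
  shows "(A *\<^sub>v v) \<bullet>c w = v \<bullet>c (A *\<^sub>v w)"
  using cscalar_prod_adjoint[OF assms(1,3,4)] assms(2) by (simp add: hermitian_mat_def)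

lemma hermitian_mat_minus:
  assumes "A \<in> carrier_mat n n" "B \<in> carrier_mat n n" "hermitian_mat A" "hermitian_mat B"
  shows "hermitian_mat (A - B)"
  unfolding hermitian_mat_def
proof (rule eq_matI)
  fix i j assume "i < dim_row (A - B)" "j < dim_col (A - B)"
  then show "mat_adjoint (A - B) $$ (i, j) = (A - B) $$ (i, j)"
    using assms mat_adjoint_index[of i A j] mat_adjoint_index[of i B j]
    by (auto simp: hermitian_mat_def)
qed (use assms in auto)

lemma hermitian_mat_square:
  assumes "A \<in> carrier_mat n n" "hermitian_mat A"
  shows "hermitian_mat (A * A)"
  using mat_adjoint_mult[OF assms(1,1)] assms(2) by (simp add: hermitian_mat_def)

lemma hermitian_mat_smult_one: "hermitian_mat (complex_of_real c \<cdot>\<^sub>m 1\<^sub>m n)"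
  unfolding hermitian_mat_def by (rule eq_matI) auto

section \<open>The spectral theorem\<close>

definition unitary_mat :: "nat \<Rightarrow> complex mat \<Rightarrow> bool" where
  "unitary_mat n U \<longleftrightarrow>
     U \<in> carrier_mat n n \<and> mat_adjoint U * U = 1\<^sub>m n \<and> U * mat_adjoint U = 1\<^sub>m n"

definition diag_of :: "nat \<Rightarrow> (nat \<Rightarrow> real) \<Rightarrow> complex mat" where
  "diag_of n d = mat n n (\<lambda>(i, j). if i = j then complex_of_real (d i) else 0)"

text \<open>
  The functional calculus: with \<open>d\<close> listing the eigenvalues of a matrix in the eigenbasis \<open>U\<close>,
  the matrix obtained by applying \<open>f\<close> to it is \<open>spectral_mat n U (f \<circ> d)\<close>.\<close>

definition spectral_mat :: "nat \<Rightarrow> complex mat \<Rightarrow> (nat \<Rightarrow> real) \<Rightarrow> complex mat" where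
  "spectral_mat n U d = U * diag_of n d * mat_adjoint U"

lemma diag_of_carrier [simp]: "diag_of n d \<in> carrier_mat n n"
  by (simp add: diag_of_def)

lemma spectral_mat_carrier [simp]: "U \<in> carrier_mat n n \<Longrightarrow> spectral_mat n U d \<in> carrier_mat n n"
  unfolding spectral_mat_def by (auto simp: diag_of_def)

lemma unitary_mat_mult:
  assumes "unitary_mat n U" "unitary_mat n V"
  shows "unitary_mat n (U * V)"
proof -
  have c: "U \<in> carrier_mat n n" "V \<in> carrier_mat n n"
    "mat_adjoint U \<in> carrier_mat n n" "mat_adjoint V \<in> carrier_mat n n"
    using assms by (auto simp: unitary_mat_def)
  have "mat_adjoint (U * V) * (U * V) = mat_adjoint V * (mat_adjoint U * U) * V"
    using c by (simp add: mat_adjoint_mult[OF c(1,2)] assoc_square_mat[of _ n]  mult_square_mat[of _ n])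
  moreover have "(U * V) * mat_adjoint (U * V) = U * (V * mat_adjoint V) * mat_adjoint U"
    using c by (simp add: mat_adjoint_mult[OF c(1,2)] assoc_square_mat[of _ n]  mult_square_mat[of _ n])
  ultimately show ?thesis
    using assms c by (simp add: unitary_mat_def)
qed

text \<open>Completing \<open>v\<close> to a basis and orthogonalising keeps \<open>v\<close> as the head of the list, so only a
  normalisation of the columns is left. The scalar \<open>c\<close> is the normalising factor of the first one.\<close>

lemma ex_unitary_mat_col:
  fixes v :: "complex vec"
  assumes v: "v \<in> carrier_vec n" and v0: "v \<noteq> 0\<^sub>v n" and n: "n > 0"
  shows "\<exists>U c. unitary_mat n U \<and> col U 0 = c \<cdot>\<^sub>v v"
proof -
  interpret cof_vec_space n "TYPE(complex)" .
  define b where "b = basis_completion v"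
  define ws where "ws = gram_schmidt n b"
  from basis_completion[OF v v0, folded b_def]
  have dist_b: "distinct b" and indep: "\<not> lin_dep (set b)" and b: "set b \<subseteq> carrier_vec n"
    and hdb: "hd b = v" and len_b: "length b = n" by auto
  from hdb len_b n obtain vs where bv: "b = v # vs" by (cases b) auto
  from gram_schmidt_result[OF b dist_b indep refl, folded ws_def]
  have ws: "set ws \<subseteq> carrier_vec n" "corthogonal ws" "length ws = n"
    by (auto simp: len_b)
  from gram_schmidt_hd[OF v, of vs, folded bv] have hdws: "hd ws = v" unfolding ws_def .
  have wsc: "ws ! i \<in> carrier_vec n" if "i < n" for i using ws that by auto
  define r where "r = (\<lambda>i. complex_of_real (1 / sqrt (Re (ws ! i \<bullet>c ws ! i))))"
  define U where "U = mat n n (\<lambda>(i, j). r j * (ws ! j) $ i)"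
  have Uc: "U \<in> carrier_mat n n" by (simp add: U_def)
  have colU: "col U j = r j \<cdot>\<^sub>v (ws ! j)" if "j < n" for j
    using that wsc[OF that] by (intro eq_vecI) (auto simp: U_def)
  have norm1: "r j * cnj (r j) * (ws ! j \<bullet>c ws ! j) = 1" if "j < n" for j
  proof -
    let ?s = "\<Sum>i<n. (cmod ((ws ! j) $ i))\<^sup>2"
    have s: "ws ! j \<bullet>c ws ! j = complex_of_real ?s" using wsc[OF that] by (rule cscalar_prod_self)
    moreover have "ws ! j \<bullet>c ws ! j \<noteq> 0" using corthogonalD[OF ws(2), of j j] ws(3) that by auto
    ultimately have "?s \<noteq> 0" by (metis of_real_0)
    moreover have "?s \<ge> 0" by (intro sum_nonneg) auto
    ultimately have "1 / sqrt ?s * (1 / sqrt ?s) * ?s = 1"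
      by (simp add: field_simps)
    moreover have "r j = complex_of_real (1 / sqrt ?s)" by (simp add: r_def s del: of_real_sum)
    ultimately show ?thesis unfolding s
      by (simp only: complex_cnj_complex_of_real of_real_1 flip: of_real_mult)
  qed
  have UU: "mat_adjoint U * U = 1\<^sub>m n"
  proof (rule eq_matI)
    fix i j assume "i < dim_row (1\<^sub>m n :: complex mat)" "j < dim_col (1\<^sub>m n :: complex mat)"
    then have ij: "i < n" "j < n" by auto
    have "(mat_adjoint U * U) $$ (i, j) = col U j \<bullet>c col U i"
      using ij Uc by (auto simp: scalar_prod_def mult.commute intro!: sum.cong)
    also have "\<dots> = r j * cnj (r i) * (ws ! j \<bullet>c ws ! i)"
      using ij wsc by (simp add: colU cscalar_prod_smult_left[of _ n] cscalar_prod_smult_right[of _ n])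
    also have "\<dots> = 1\<^sub>m n $$ (i, j)"
      using ij norm1[of j] corthogonalD[OF ws(2), of j i] ws(3) by (cases "i = j") auto
    finally show "(mat_adjoint U * U) $$ (i, j) = 1\<^sub>m n $$ (i, j)" .
  qed (use Uc in auto)
  have "U * mat_adjoint U = 1\<^sub>m n"
    using mat_mult_left_right_inverse[OF mat_adjoint_carrier[OF Uc] Uc UU] .
  moreover have "col U 0 = r 0 \<cdot>\<^sub>v v" using colU[OF n] hdws ws(3) n by (cases ws) auto
  ultimately show ?thesis using Uc UU unfolding unitary_mat_def by blast
qed

lemma mat_adjoint_four_block_diag:
  fixes A D :: "complex mat"
  assumes "A \<in> carrier_mat p p" "D \<in> carrier_mat q q"
  shows "mat_adjoint (four_block_mat A (0\<^sub>m p q) (0\<^sub>m q p) D)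
    = four_block_mat (mat_adjoint A) (0\<^sub>m p q) (0\<^sub>m q p) (mat_adjoint D)"
  using assms by (intro eq_matI) auto

lemma mult_four_block_diag:
  fixes A D :: "complex mat"
  assumes "A \<in> carrier_mat p p" "D \<in> carrier_mat q q" "A' \<in> carrier_mat p p" "D' \<in> carrier_mat q q"
  shows "four_block_mat A (0\<^sub>m p q) (0\<^sub>m q p) D * four_block_mat A' (0\<^sub>m p q) (0\<^sub>m q p) D'
    = four_block_mat (A * A') (0\<^sub>m p q) (0\<^sub>m q p) (D * D')"
  using assms by (subst mult_four_block_mat[of _ p p _ q _ q _ _ p _ q]) auto

text \<open>Conjugating \<open>A\<close> by a unitary whose first column is an eigenvector makes the first column of the
  result a multiple \<open>e\<close> of the first unit vector. As the result is still Hermitian, its first row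
  has the same shape and \<open>e\<close> is real, so the induction continues with the lower right block.\<close>

theorem spectral_theorem:
  assumes "A \<in> carrier_mat n n" "hermitian_mat A"
  shows "\<exists>U d. unitary_mat n U \<and> A = spectral_mat n U d"
  using assms
proof (induction n arbitrary: A)
  case 0
  then have "A = spectral_mat 0 (1\<^sub>m 0) (\<lambda>_. 0)"
    by (intro eq_matI) (auto simp: spectral_mat_def)
  moreover have "unitary_mat 0 (1\<^sub>m 0)"
    unfolding unitary_mat_def by (auto intro!: eq_matI)
  ultimately show ?case by blast
next
  case (Suc m)
  let ?n = "Suc m"
  have A: "A \<in> carrier_mat ?n ?n" and hA: "mat_adjoint A = A"
    using Suc.prems by (auto simp: hermitian_mat_def)
  obtain e where "eigenvalue A e"
    using spectrum_non_empty[OF A] by (auto simp: spectrum_def)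
  then obtain v where v: "v \<in> carrier_vec ?n" "v \<noteq> 0\<^sub>v ?n" "A *\<^sub>v v = e \<cdot>\<^sub>v v"
    using A by (auto simp: eigenvalue_def eigenvector_def)
  obtain U c where U: "unitary_mat ?n U" and col: "col U 0 = c \<cdot>\<^sub>v v"
    using ex_unitary_mat_col[OF v(1,2)] by auto
  have Uc: "U \<in> carrier_mat ?n ?n" "mat_adjoint U \<in> carrier_mat ?n ?n"
    using U by (auto simp: unitary_mat_def)
  define B where "B = mat_adjoint U * (A * U)"
  have B: "B \<in> carrier_mat ?n ?n" using Uc A by (auto simp: B_def)
  have AB: "A = U * B * mat_adjoint U"
  proof -
    have "U * B * mat_adjoint U = (U * mat_adjoint U) * A * (U * mat_adjoint U)"
      using Uc A by (simp add: B_def assoc_square_mat[of _ ?n]  mult_square_mat[of _ ?n])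
    then show ?thesis using U A by (simp add: unitary_mat_def)
  qed
  have hB: "mat_adjoint B = B"
  proof -
    have "mat_adjoint B = mat_adjoint (A * U) * U"
      unfolding B_def using Uc A by (simp add: mat_adjoint_mult[of _ ?n ?n _ ?n])
    also have "\<dots> = mat_adjoint U * A * U"
      using Uc A hA by (simp add: mat_adjoint_mult[of _ ?n ?n _ ?n])
    finally show ?thesis using Uc A by (simp add: B_def assoc_square_mat[of _ ?n]  mult_square_mat[of _ ?n])
  qed
  have Bsym: "B $$ (i, j) = cnj (B $$ (j, i))" if "i < ?n" "j < ?n" for i j
    using mat_adjoint_index[of i B j] B that by (simp add: hB)
  have B0: "B $$ (i, 0) = (if i = 0 then e else 0)" if i: "i < ?n" for i
  proof -
    have "B $$ (i, 0) = row (mat_adjoint U) i \<bullet> col (A * U) 0"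
      using Uc A i by (simp add: B_def)
    also have "col (A * U) 0 = A *\<^sub>v col U 0" using Uc A by (auto simp: col_mult2[of _ ?n ?n _ ?n])
    also have "\<dots> = e \<cdot>\<^sub>v col U 0"
      using A v by (auto simp: col mult_mat_vec[of _ ?n ?n] smult_smult_assoc mult.commute)
    also have "row (mat_adjoint U) i \<bullet> (e \<cdot>\<^sub>v col U 0) = e * (mat_adjoint U * U) $$ (i, 0)"
      using Uc i by simp
    also have "(mat_adjoint U * U) $$ (i, 0) = (if i = 0 then 1 else 0)"
      using U i by (simp add: unitary_mat_def)
    finally show ?thesis by simp
  qed
  have e: "e = complex_of_real (Re e)"
    using Bsym[of 0 0] B0[of 0] by (simp add: complex_eq_iff)
  define C where "C = mat m m (\<lambda>(i, j). B $$ (Suc i, Suc j))"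
  have C: "C \<in> carrier_mat m m" by (simp add: C_def)
  have "hermitian_mat C"
    unfolding hermitian_mat_def
    by (rule eq_matI) (auto simp: C_def Bsym[symmetric])
  then obtain V d where V: "unitary_mat m V" and CV: "C = spectral_mat m V d"
    using Suc.IH[OF C] by blast
  have Vc: "V \<in> carrier_mat m m" "mat_adjoint V \<in> carrier_mat m m"
    using V by (auto simp: unitary_mat_def)
  define blk where "blk = (\<lambda>x Y. four_block_mat x (0\<^sub>m 1 m) (0\<^sub>m m 1) (Y :: complex mat))"
  define E where "E = mat 1 1 (\<lambda>_. e)"
  define W where "W = blk (1\<^sub>m 1) V"
  define f where "f = (\<lambda>i. case i of 0 \<Rightarrow> Re e | Suc i \<Rightarrow> d i)"
  have [simp]: "mat_adjoint (1\<^sub>m q :: complex mat) = 1\<^sub>m q" for q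
    by (rule eq_matI) auto
  have Ec: "E \<in> carrier_mat 1 1" by (simp add: E_def)
  have aW: "mat_adjoint W = blk (1\<^sub>m 1) (mat_adjoint V)"
    unfolding W_def blk_def using Vc by (subst mat_adjoint_four_block_diag) auto
  have blk_mult: "blk X Y * blk X' Y' = blk (X * X') (Y * Y')"
    if "X \<in> carrier_mat 1 1" "X' \<in> carrier_mat 1 1" "Y \<in> carrier_mat m m" "Y' \<in> carrier_mat m m"
    for X X' Y Y'
    unfolding blk_def using that by (intro mult_four_block_diag)
  have blk_one: "blk (1\<^sub>m 1) (1\<^sub>m m) = 1\<^sub>m ?n"
    unfolding blk_def by (rule eq_matI) auto
  have W: "unitary_mat ?n W"
    using V Vc unfolding unitary_mat_def aW
    by (auto simp: W_def blk_mult blk_one) (auto simp: blk_def)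
  have Wc: "W \<in> carrier_mat ?n ?n" "mat_adjoint W \<in> carrier_mat ?n ?n"
    using W by (auto simp: unitary_mat_def)
  have D: "diag_of ?n f = blk E (diag_of m d)"
    unfolding blk_def
    by (rule eq_matI) (use e in \<open>auto simp: diag_of_def E_def f_def split: nat.split\<close>)
  have "B = blk E C"
  proof (rule eq_matI)
    fix i j assume "i < dim_row (blk E C)" "j < dim_col (blk E C)"
    then have ij: "i < ?n" "j < ?n" by (auto simp: blk_def C_def E_def)
    have Br: "B $$ (0, j) = (if j = 0 then e else 0)"
      using Bsym[of 0 j] B0[OF ij(2)] e ij(2) by (metis complex_cnj_complex_of_real complex_cnj_zero zero_less_Suc)
    show "B $$ (i, j) = blk E C $$ (i, j)"
      using B0[OF ij(1)] Br ij
      by (cases i; cases j) (auto simp: blk_def C_def E_def)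
  qed (use B in \<open>auto simp: blk_def C_def E_def\<close>)
  also have "\<dots> = W * diag_of ?n f * mat_adjoint W"
    unfolding D aW unfolding W_def using Vc Ec by (simp add: blk_mult CV spectral_mat_def)
  finally have BW: "B = W * diag_of ?n f * mat_adjoint W" .
  have "U * (W * diag_of ?n f * mat_adjoint W) * mat_adjoint U = spectral_mat ?n (U * W) f"
    unfolding spectral_mat_def using Uc Wc diag_of_carrier[of ?n f]
    by (simp add: mat_adjoint_mult[of _ ?n ?n _ ?n] assoc_square_mat[of _ ?n]  mult_square_mat[of _ ?n])
  then have "A = spectral_mat ?n (U * W) f" using AB BW by simp
  with unitary_mat_mult[OF U W] show ?case by blast
qed


section \<open>Functional calculus in a fixed eigenbasis\<close>

lemma unitary_matD:
  assumes "unitary_mat n U"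
  shows "U \<in> carrier_mat n n" "mat_adjoint U \<in> carrier_mat n n"
    "mat_adjoint U * U = 1\<^sub>m n" "U * mat_adjoint U = 1\<^sub>m n"
  using assms by (auto simp: unitary_mat_def)

lemma diag_of_mult: "diag_of n d * diag_of n e = diag_of n (\<lambda>i. d i * e i)"
  by (rule eq_matI) (auto simp: diag_of_def scalar_prod_def if_distrib[of "\<lambda>x. x * _"] cong: if_cong)

lemma spectral_mat_index:
  assumes "U \<in> carrier_mat n n" "a < n" "b < n"
  shows "spectral_mat n U d $$ (a, b) = (\<Sum>i<n. complex_of_real (d i) * (U $$ (a, i) * cnj (U $$ (b, i))))"
proof -
  have "(U * diag_of n d) $$ (a, i) = U $$ (a, i) * complex_of_real (d i)" if "i < n" for i
    using assms that
    by (auto simp: diag_of_def scalar_prod_def if_distrib[of "\<lambda>x. _ * x"] cong: if_cong)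
  then show ?thesis
    using assms by (auto simp: spectral_mat_def diag_of_def scalar_prod_def lessThan_atLeast0 mult_ac
        simp del: index_mult_mat(1) intro!: sum.cong simp: index_mult_mat(1)[of _ "U * _"])
qed

lemma spectral_mat_cong:
  assumes "\<And>i. i < n \<Longrightarrow> d i = e i"
  shows "spectral_mat n U d = spectral_mat n U e"
proof -
  have "diag_of n d = diag_of n e" using assms by (auto simp: diag_of_def intro!: eq_matI)
  then show ?thesis by (simp add: spectral_mat_def)
qed

lemma spectral_mat_mult:
  assumes "unitary_mat n U"
  shows "spectral_mat n U d * spectral_mat n U e = spectral_mat n U (\<lambda>i. d i * e i)"
proof -
  note U = unitary_matD[OF assms]
  have "spectral_mat n U d * spectral_mat n U e
      = U * diag_of n d * (mat_adjoint U * U) * diag_of n e * mat_adjoint U"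
    unfolding spectral_mat_def using U(1,2) diag_of_carrier[of n d] diag_of_carrier[of n e]
    by (simp add: assoc_square_mat[of _ n] mult_square_mat[of _ n])
  also have "\<dots> = U * (diag_of n d * diag_of n e) * mat_adjoint U"
    using U(1,2) diag_of_carrier[of n d] diag_of_carrier[of n e]
    by (simp add: U(3) left_mult_one_mat[of _ n n] assoc_square_mat[of _ n] mult_square_mat[of _ n])
  finally show ?thesis by (simp add: diag_of_mult spectral_mat_def)
qed

lemma spectral_mat_add:
  "U \<in> carrier_mat n n \<Longrightarrow>
    spectral_mat n U d + spectral_mat n U e = spectral_mat n U (\<lambda>i. d i + e i)"
  by (rule eq_matI)
    (auto simp: spectral_mat_index carrier_matD[OF spectral_mat_carrier] sum.distrib distrib_right)

lemma spectral_mat_minus: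
  "U \<in> carrier_mat n n \<Longrightarrow>
    spectral_mat n U d - spectral_mat n U e = spectral_mat n U (\<lambda>i. d i - e i)"
  by (rule eq_matI)
    (auto simp: spectral_mat_index carrier_matD[OF spectral_mat_carrier] sum_subtractf left_diff_distrib)

lemma spectral_mat_smult:
  "U \<in> carrier_mat n n \<Longrightarrow>
    complex_of_real c \<cdot>\<^sub>m spectral_mat n U d = spectral_mat n U (\<lambda>i. c * d i)"
  by (rule eq_matI)
    (auto simp: spectral_mat_index carrier_matD[OF spectral_mat_carrier] sum_distrib_left mult_ac)

lemma spectral_mat_const:
  assumes "unitary_mat n U"
  shows "spectral_mat n U (\<lambda>_. c) = complex_of_real c \<cdot>\<^sub>m 1\<^sub>m n"
proof -
  note U = unitary_matD[OF assms]
  have "diag_of n (\<lambda>_. 1) = 1\<^sub>m n" by (rule eq_matI) (auto simp: diag_of_def)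
  then have "spectral_mat n U (\<lambda>_. 1) = 1\<^sub>m n" using U by (simp add: spectral_mat_def)
  with spectral_mat_smult[OF U(1), of c "\<lambda>_. 1"] show ?thesis by simp
qed

lemma hermitian_spectral_mat:
  assumes "U \<in> carrier_mat n n"
  shows "hermitian_mat (spectral_mat n U d)"
  unfolding hermitian_mat_def using carrier_matD[OF spectral_mat_carrier[OF assms, of d]]
  by (intro eq_matI) (auto simp: spectral_mat_index[OF assms] mult_ac)

lemma diag_of_mult_vec:
  "y \<in> carrier_vec n \<Longrightarrow> diag_of n d *\<^sub>v y = vec n (\<lambda>i. complex_of_real (d i) * y $ i)"
  by (rule eq_vecI) (auto simp: diag_of_def scalar_prod_def if_distrib[of "\<lambda>x. x * _"] cong: if_cong)

lemma spectral_mat_mult_vec: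
  assumes "U \<in> carrier_mat n n" "x \<in> carrier_vec n"
  shows "spectral_mat n U d *\<^sub>v x = U *\<^sub>v (diag_of n d *\<^sub>v (mat_adjoint U *\<^sub>v x))"
  unfolding spectral_mat_def using assms
  by (simp add: assoc_mult_mat_vec[of _ n n _ n] mult_square_mat[of _ n] mult_mat_vec_carrier[of _ n n])

text \<open>In the coordinates given by the eigenbasis the quadratic form is diagonal; this is what turns
  positive semidefiniteness into nonnegativity of the eigenvalues.\<close>

lemma spectral_mat_quadratic_form:
  assumes "U \<in> carrier_mat n n" "x \<in> carrier_vec n"
  shows "(spectral_mat n U d *\<^sub>v x) \<bullet>c x
    = complex_of_real (\<Sum>i<n. d i * (cmod ((mat_adjoint U *\<^sub>v x) $ i))\<^sup>2)"
proof -
  define y where "y = mat_adjoint U *\<^sub>v x"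
  have y: "y \<in> carrier_vec n"
    unfolding y_def using assms by (intro mult_mat_vec_carrier[of _ n n]) auto
  have "(spectral_mat n U d *\<^sub>v x) \<bullet>c x = (diag_of n d *\<^sub>v y) \<bullet>c y"
    using assms y unfolding spectral_mat_mult_vec[OF assms]
    by (simp add: y_def[symmetric] cscalar_prod_adjoint[of _ n n] diag_of_mult_vec)
  also have "\<dots> = (\<Sum>i<n. complex_of_real (d i) * (y $ i * cnj (y $ i)))"
    using y by (simp add: diag_of_mult_vec cscalar_prod_sum[of _ n] mult_ac)
  finally show ?thesis
    by (simp add: y_def complex_norm_square del: of_real_power)
qed

lemma adjoint_mult_col:
  assumes "unitary_mat n U" "i < n"
  shows "mat_adjoint U *\<^sub>v col U i = unit_vec n i"
proof -
  note U = unitary_matD[OF assms(1)]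
  have "mat_adjoint U *\<^sub>v col U i = col (mat_adjoint U * U) i"
    using U(1,2) assms(2) by (auto simp: col_mult2[of _ n n _ n])
  then show ?thesis using assms(2) by (simp add: U(3))
qed

lemma spectral_mat_mult_col:
  assumes "unitary_mat n U" "i < n"
  shows "spectral_mat n U d *\<^sub>v col U i = complex_of_real (d i) \<cdot>\<^sub>v col U i"
proof -
  note U = unitary_matD[OF assms(1)]
  have c: "col U i \<in> carrier_vec n" using U(1) assms(2) by auto
  have "diag_of n d *\<^sub>v unit_vec n i = complex_of_real (d i) \<cdot>\<^sub>v unit_vec n i"
    using assms(2) by (auto simp: diag_of_mult_vec intro!: eq_vecI)
  then have "spectral_mat n U d *\<^sub>v col U i = complex_of_real (d i) \<cdot>\<^sub>v (U *\<^sub>v unit_vec n i)"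
    using spectral_mat_mult_vec[OF U(1) c] adjoint_mult_col[OF assms] U(1)
    by (simp add: mult_mat_vec[of _ n n])
  also have "U *\<^sub>v unit_vec n i = col U i"
    unfolding adjoint_mult_col[OF assms, symmetric]
    using U c by (simp add: assoc_mult_mat_vec[of _ n n _ n, symmetric])
  finally show ?thesis .
qed

lemma unitary_mat_col_norm:
  assumes "unitary_mat n U" "i < n"
  shows "col U i \<in> carrier_vec n" "col U i \<bullet>c col U i = 1"
proof -
  note U = unitary_matD[OF assms(1)]
  show c: "col U i \<in> carrier_vec n" using U(1) assms(2) by auto
  have "col U i \<bullet>c col U i = (mat_adjoint U * U) $$ (i, i)"
    using U(1) assms(2) by (auto simp: scalar_prod_def mult.commute intro!: sum.cong)
  then show "col U i \<bullet>c col U i = 1" using assms(2) by (simp add: U(3))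
qed

lemma psd_spectral_mat_iff:
  assumes "unitary_mat n U"
  shows "psd n (spectral_mat n U d) \<longleftrightarrow> (\<forall>i<n. 0 \<le> d i)"
proof
  note U = unitary_matD[OF assms]
  assume psd: "psd n (spectral_mat n U d)"
  show "\<forall>i<n. 0 \<le> d i"
  proof (intro allI impI)
    fix i assume i: "i < n"
    note c = unitary_mat_col_norm[OF assms i]
    have "0 \<le> (spectral_mat n U d *\<^sub>v col U i) \<bullet>c col U i"
      using psd c(1) by (auto simp: psd_def)
    then have "0 \<le> complex_of_real (d i)"
      using c by (simp add: spectral_mat_mult_col[OF assms i] cscalar_prod_smult_left[of _ n])
    then show "0 \<le> d i" by (simp add: less_eq_complex_def)
  qed
next
  note U = unitary_matD[OF assms]
  assume "\<forall>i<n. 0 \<le> d i"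
  then show "psd n (spectral_mat n U d)"
    unfolding psd_def using U(1)
    by (auto simp: hermitian_spectral_mat spectral_mat_quadratic_form intro!: sum_nonneg
        simp del: of_real_sum simp: less_eq_complex_def)
qed

section \<open>The positive semidefinite square root\<close>

text \<open>Let \<open>u\<close> be an eigenvector of the Hermitian matrix \<open>B - C\<close> for \<open>e\<close>. Comparing the squared norms of
  \<open>B u\<close> and \<open>C u\<close>, which agree because \<open>B\<^sup>2 = C\<^sup>2\<close>, gives \<open>e (\<langle>B u, u\<rangle> + \<langle>C u, u\<rangle>) = 0\<close>. Both
  summands are nonnegative, so if \<open>e\<close> were nonzero both would vanish, and so would their difference \<open>e\<close>.\<close>

lemma psd_square_unique:
  assumes B: "psd n B" and C: "psd n C" and eq: "B * B = C * C"
  shows "B = C"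
proof -
  have Bc: "B \<in> carrier_mat n n" "hermitian_mat B" and Cc: "C \<in> carrier_mat n n" "hermitian_mat C"
    using B C by (auto simp: psd_def)
  have "hermitian_mat (B - C)" using Bc Cc by (intro hermitian_mat_minus)
  then obtain U e where U: "unitary_mat n U" and BC: "B - C = spectral_mat n U e"
    using spectral_theorem[of "B - C" n] Bc Cc by (auto intro: minus_carrier_mat)
  have "e i = 0" if i: "i < n" for i
  proof -
    define u where "u = col U i"
    note u = unitary_mat_col_norm[OF U i, folded u_def]
    have Bu: "B *\<^sub>v u \<in> carrier_vec n" and Cu: "C *\<^sub>v u \<in> carrier_vec n"
      using Bc Cc u by auto
    have "B *\<^sub>v u - C *\<^sub>v u = complex_of_real (e i) \<cdot>\<^sub>v u"
      using spectral_mat_mult_col[OF U i, of e] Bc Cc u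
      by (simp add: BC[symmetric] u_def[symmetric] minus_mult_distrib_mat_vec[of _ n n])
    then have diff: "(B *\<^sub>v u) \<bullet>c w - (C *\<^sub>v u) \<bullet>c w = complex_of_real (e i) * (u \<bullet>c w)"
      and diff': "w \<bullet>c (B *\<^sub>v u) - w \<bullet>c (C *\<^sub>v u) = complex_of_real (e i) * (w \<bullet>c u)"
      if "w \<in> carrier_vec n" for w
      using that Bu Cu u(1)
      by (simp_all add: cscalar_prod_minus_left[of _ n, symmetric] cscalar_prod_minus_right[of _ n, symmetric]
          cscalar_prod_smult_left[of _ n] cscalar_prod_smult_right[of _ n])
    have "(B *\<^sub>v u) \<bullet>c (B *\<^sub>v u) = ((B * B) *\<^sub>v u) \<bullet>c u"
      using Bc u by (simp add: hermitian_cscalar_prod[of _ n, symmetric] assoc_mult_mat_vec[of _ n n _ n])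
    also have "\<dots> = (C *\<^sub>v u) \<bullet>c (C *\<^sub>v u)"
      using Cc u unfolding eq
      by (simp add: hermitian_cscalar_prod[of _ n, symmetric] assoc_mult_mat_vec[of _ n n _ n])
    finally have "complex_of_real (e i) * ((B *\<^sub>v u) \<bullet>c u + u \<bullet>c (C *\<^sub>v u)) = 0"
      unfolding distrib_left diff[OF Cu, symmetric] diff'[OF Bu, symmetric] by simp
    moreover have "u \<bullet>c (C *\<^sub>v u) = (C *\<^sub>v u) \<bullet>c u"
      using Cc u by (simp add: hermitian_cscalar_prod[of _ n])
    moreover have "0 \<le> (B *\<^sub>v u) \<bullet>c u" "0 \<le> (C *\<^sub>v u) \<bullet>c u"
      using B C u by (auto simp: psd_def)
    ultimately have "e i = 0 \<or> (B *\<^sub>v u) \<bullet>c u = 0 \<and> (C *\<^sub>v u) \<bullet>c u = 0"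
      by (auto simp: add_nonneg_eq_0_iff)
    then show "e i = 0" using diff[OF u(1)] u(2) by auto
  qed
  then have "B - C = spectral_mat n U (\<lambda>_. 0)" unfolding BC by (intro spectral_mat_cong) auto
  then have "B - C = 0 \<cdot>\<^sub>m 1\<^sub>m n" by (simp add: spectral_mat_const[OF U])
  then have "(B - C) $$ (i, j) = 0" if "i < n" "j < n" for i j
    using that by simp
  then have "B $$ (i, j) = C $$ (i, j)" if "i < n" "j < n" for i j
    using that Bc(1) Cc(1) by simp
  then show ?thesis using Bc Cc by (intro eq_matI) auto
qed

lemma pow_mat_two: "A \<in> carrier_mat n n \<Longrightarrow> A ^\<^sub>m 2 = A * A"
  by (simp add: numeral_2_eq_2)

text \<open>This makes the definite description concrete: the entrywise root of the eigenvalues exists, and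
  uniqueness of the square root identifies it.\<close>

lemma psd_sqrt_spectral_mat:
  assumes U: "unitary_mat n U" and d: "\<And>i. i < n \<Longrightarrow> 0 \<le> d i"
  shows "psd_sqrt n (spectral_mat n U d) = spectral_mat n U (\<lambda>i. sqrt (d i))"
  unfolding psd_sqrt_def
proof (rule the_equality)
  note Uc = unitary_matD(1)[OF U]
  let ?R = "spectral_mat n U (\<lambda>i. sqrt (d i))"
  have R: "psd n ?R" "?R * ?R = spectral_mat n U d"
    using d by (auto simp: psd_spectral_mat_iff[OF U] spectral_mat_mult[OF U] intro!: spectral_mat_cong)
  then show "psd n ?R \<and> ?R ^\<^sub>m 2 = spectral_mat n U d"
    using Uc by (simp add: pow_mat_two[of _ n])
  fix B assume "psd n B \<and> B ^\<^sub>m 2 = spectral_mat n U d"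
  then have B: "psd n B" "B * B = spectral_mat n U d"
    using pow_mat_two[of B n] by (auto simp: psd_def)
  show "B = ?R" by (rule psd_square_unique[OF B(1) R(1)]) (simp only: B(2) R(2))
qed


section \<open>Positive unital maps: Kadison's inequality and the variance bound\<close>

locale positive_unital_map =
  fixes n k :: nat and \<Phi> :: "complex mat \<Rightarrow> complex mat"
  assumes linear:
      "linear_map class_ring (module_mat TYPE(complex) n n) (module_mat TYPE(complex) k k) \<Phi>"
    and positive: "positive_mat_map n k \<Phi>"
    and unital: "unital_mat_map n k \<Phi>"
begin

lemma map_carrier [simp]: "X \<in> carrier_mat n n \<Longrightarrow> \<Phi> X \<in> carrier_mat k k"
  using linear by (auto simp: linear_map_mat_iff)

lemma map_add: "X \<in> carrier_mat n n \<Longrightarrow> Y \<in> carrier_mat n n \<Longrightarrow> \<Phi> (X + Y) = \<Phi> X + \<Phi> Y"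
  using linear by (auto simp: linear_map_mat_iff)

lemma map_smult: "X \<in> carrier_mat n n \<Longrightarrow> \<Phi> (c \<cdot>\<^sub>m X) = c \<cdot>\<^sub>m \<Phi> X"
  using linear by (auto simp: linear_map_mat_iff)

lemma map_one: "\<Phi> (1\<^sub>m n) = 1\<^sub>m k"
  using unital by (simp add: unital_mat_map_def)

lemma map_psd: "psd n X \<Longrightarrow> psd k (\<Phi> X)"
  using positive by (simp add: positive_mat_map_def)

lemma map_minus:
  assumes X: "X \<in> carrier_mat n n" and Y: "Y \<in> carrier_mat n n"
  shows "\<Phi> (X - Y) = \<Phi> X - \<Phi> Y"
proof -
  have d: "X - Y \<in> carrier_mat n n" using Y by (rule minus_carrier_mat)
  have "X - Y + Y = X" using X Y by (intro eq_matI) auto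
  then have sum: "\<Phi> X = \<Phi> (X - Y) + \<Phi> Y" using map_add[OF d Y] by simp
  show ?thesis unfolding sum
    using map_carrier[OF d] map_carrier[OF Y] by (intro eq_matI) auto
qed

text \<open>A Hermitian matrix is a difference of two positive semidefinite ones.\<close>

lemma map_hermitian:
  assumes "A \<in> carrier_mat n n" "hermitian_mat A"
  shows "hermitian_mat (\<Phi> A)"
proof -
  obtain U d where U: "unitary_mat n U" and A: "A = spectral_mat n U d"
    using spectral_theorem[OF assms] by blast
  note Uc = unitary_matD(1)[OF U]
  let ?p = "spectral_mat n U (\<lambda>i. max (d i) 0)" and ?q = "spectral_mat n U (\<lambda>i. max (- d i) 0)"
  have "A = ?p - ?q"
    unfolding A spectral_mat_minus[OF Uc] by (rule spectral_mat_cong) auto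
  then have "\<Phi> A = \<Phi> ?p - \<Phi> ?q" using Uc by (simp add: map_minus)
  moreover have "psd k (\<Phi> ?p)" "psd k (\<Phi> ?q)"
    by (auto intro!: map_psd simp: psd_spectral_mat_iff[OF U])
  ultimately show ?thesis
    using hermitian_mat_minus[of "\<Phi> ?p" k "\<Phi> ?q"] by (simp add: psd_def)
qed

text \<open>This is \<open>\<Phi>(A) = \<Sum>\<^sub>i d\<^sub>i Q\<^sub>i\<close>, where \<open>Q\<^sub>i\<close> is the image of the \<open>i\<close>-th spectral projection, tested against
  vectors so that only sums of numbers occur.\<close>

lemma map_spectral_mat:
  assumes U: "unitary_mat n U" and x: "x \<in> carrier_vec k" and y: "y \<in> carrier_vec k"
  shows "(\<Phi> (spectral_mat n U d) *\<^sub>v x) \<bullet>c y = (\<Sum>i<n. complex_of_real (d i) *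
    ((\<Phi> (spectral_mat n U (\<lambda>j. if j = i then 1 else 0)) *\<^sub>v x) \<bullet>c y))"
proof -
  note Uc = unitary_matD(1)[OF U]
  define L where "L = (\<lambda>e. (\<Phi> (spectral_mat n U e) *\<^sub>v x) \<bullet>c y)"
  have c: "\<Phi> (spectral_mat n U e) \<in> carrier_mat k k" for e using Uc by simp
  have Lx: "\<Phi> (spectral_mat n U e) *\<^sub>v x \<in> carrier_vec k" for e
    using c x by (rule mult_mat_vec_carrier)
  have add: "L (\<lambda>i. e i + f i) = L e + L f" for e f
    unfolding L_def spectral_mat_add[OF Uc, symmetric]
    using Uc c x y Lx
    by (simp add: map_add add_mult_distrib_mat_vec[of _ k k] cscalar_prod_add_left[of _ k])
  have smult: "L (\<lambda>i. r * e i) = complex_of_real r * L e" for r e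
  proof -
    have "(complex_of_real r \<cdot>\<^sub>m \<Phi> (spectral_mat n U e)) *\<^sub>v x
        = complex_of_real r \<cdot>\<^sub>v (\<Phi> (spectral_mat n U e) *\<^sub>v x)"
      using c[of e] x by (intro eq_vecI) auto
    then show ?thesis
      unfolding L_def spectral_mat_smult[OF Uc, symmetric]
      using Uc y Lx by (simp add: map_smult cscalar_prod_smult_left[of _ k])
  qed
  have "L (\<lambda>j. if j < m then d j else 0) = (\<Sum>i<m. complex_of_real (d i) * L (\<lambda>j. if j = i then 1 else 0))" for m
  proof (induction m)
    case 0
    show ?case using smult[of 0 "\<lambda>_. 0"] by simp
  next
    case (Suc m)
    have "(\<lambda>j. if j < Suc m then d j else 0)
        = (\<lambda>j. (if j < m then d j else 0) + d m * (if j = m then 1 else 0))"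
      by (auto simp: less_Suc_eq)
    then show ?case using Suc.IH by (simp add: add smult)
  qed
  from this[of n] have "L d = (\<Sum>i<n. complex_of_real (d i) * L (\<lambda>j. if j = i then 1 else 0))"
    unfolding L_def by (subst spectral_mat_cong[of n d "\<lambda>j. if j < n then d j else 0"]) auto
  then show ?thesis by (simp add: L_def)
qed

lemma variance_quadratic_form:
  assumes A: "A \<in> carrier_mat n n" "hermitian_mat A" and x: "x \<in> carrier_vec k"
  shows "((\<Phi> (A * A) - \<Phi> A * \<Phi> A) *\<^sub>v x) \<bullet>c x
    = (\<Phi> (A * A) *\<^sub>v x) \<bullet>c x - (\<Phi> A *\<^sub>v x) \<bullet>c (\<Phi> A *\<^sub>v x)"
proof -
  have c: "\<Phi> A \<in> carrier_mat k k" "\<Phi> (A * A) \<in> carrier_mat k k" using A(1) by auto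
  then have "(\<Phi> A * \<Phi> A *\<^sub>v x) \<bullet>c x = (\<Phi> A *\<^sub>v x) \<bullet>c (\<Phi> A *\<^sub>v x)"
    using x map_hermitian[OF A]
    by (simp add: hermitian_cscalar_prod[of _ k, symmetric] assoc_mult_mat_vec[of _ k k _ k])
  then show ?thesis
    using c x by (simp add: minus_mult_distrib_mat_vec[of _ k k] cscalar_prod_minus_left[of _ k]
        mult_mat_vec_carrier[of _ k k] mult_square_mat[of _ k])
qed

lemma hermitian_variance:
  assumes A: "A \<in> carrier_mat n n" "hermitian_mat A"
  shows "\<Phi> (A * A) - \<Phi> A * \<Phi> A \<in> carrier_mat k k" "hermitian_mat (\<Phi> (A * A) - \<Phi> A * \<Phi> A)"
proof -
  have c: "\<Phi> A \<in> carrier_mat k k" "\<Phi> (A * A) \<in> carrier_mat k k" using A(1) by auto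
  then show "\<Phi> (A * A) - \<Phi> A * \<Phi> A \<in> carrier_mat k k"
    by (intro minus_carrier_mat) auto
  show "hermitian_mat (\<Phi> (A * A) - \<Phi> A * \<Phi> A)"
    using c A by (intro hermitian_mat_minus[of _ k] hermitian_mat_square[of _ k] map_hermitian
        hermitian_mat_square[of _ n]) auto
qed

text \<open>Write \<open>H = \<Phi>(A) = \<Sum>\<^sub>i d\<^sub>i Q\<^sub>i\<close> with positive semidefinite \<open>Q\<^sub>i\<close> summing to the identity. Then
  \<open>\<langle>(\<Phi>(A\<^sup>2) - H\<^sup>2) x, x\<rangle> = \<Sum>\<^sub>i \<langle>Q\<^sub>i (d\<^sub>i x - H x), d\<^sub>i x - H x\<rangle>\<close>, in analogy with the formula for the
  variance of a random variable taking the value \<open>d\<^sub>i\<close> with weight \<open>Q\<^sub>i\<close>.\<close>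

theorem kadison_inequality:
  assumes A: "A \<in> carrier_mat n n" "hermitian_mat A"
  shows "psd k (\<Phi> (A * A) - \<Phi> A * \<Phi> A)"
  unfolding psd_def
proof (intro conjI ballI hermitian_variance[OF A])
  fix x :: "complex vec" assume x: "x \<in> carrier_vec k"
  obtain U d where U: "unitary_mat n U" and Ad: "A = spectral_mat n U d"
    using spectral_theorem[OF A] by blast
  note Uc = unitary_matD(1)[OF U]
  define H where "H = \<Phi> A"
  define h where "h = H *\<^sub>v x"
  define Q where "Q = (\<lambda>i. \<Phi> (spectral_mat n U (\<lambda>j. if j = i then 1 else 0)))"
  have H: "H \<in> carrier_mat k k" "hermitian_mat H"
    using A map_hermitian[OF A] by (auto simp: H_def)
  have h: "h \<in> carrier_vec k" using H x by (auto simp: h_def)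
  have Qp: "psd k (Q i)" for i
    unfolding Q_def by (intro map_psd) (auto simp: psd_spectral_mat_iff[OF U])
  then have Qc: "Q i \<in> carrier_mat k k" for i by (simp add: psd_def)
  define q where "q = (\<lambda>i a b. (Q i *\<^sub>v a) \<bullet>c b)"
  have L: "(\<Phi> (spectral_mat n U e) *\<^sub>v a) \<bullet>c b = (\<Sum>i<n. complex_of_real (e i) * q i a b)"
    if "a \<in> carrier_vec k" "b \<in> carrier_vec k" for e a b
    unfolding q_def Q_def by (rule map_spectral_mat[OF U that])
  have Qterm: "(Q i *\<^sub>v w) \<bullet>c w = complex_of_real (d i * d i) * q i x x - complex_of_real (d i) * q i x h
      - complex_of_real (d i) * q i h x + complex_of_real 1 * q i h h"
    if w: "w = complex_of_real (d i) \<cdot>\<^sub>v x - h" for i w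
  proof -
    have Qv: "Q i *\<^sub>v x \<in> carrier_vec k" "Q i *\<^sub>v h \<in> carrier_vec k"
      using Qc[of i] x h by auto
    have "Q i *\<^sub>v w = complex_of_real (d i) \<cdot>\<^sub>v (Q i *\<^sub>v x) - Q i *\<^sub>v h"
      unfolding w using Qc[of i] x h
      by (simp add: mult_minus_distrib_mat_vec[of _ k k] mult_mat_vec[of _ k k])
    then show ?thesis
      unfolding w using Qv x h
      by (simp add: q_def cscalar_prod_minus_left[of _ k] cscalar_prod_minus_right[of _ k]
          cscalar_prod_smult_left[of _ k] cscalar_prod_smult_right[of _ k] algebra_simps)
  qed
  have "0 \<le> (\<Sum>i<n. (Q i *\<^sub>v (complex_of_real (d i) \<cdot>\<^sub>v x - h)) \<bullet>c (complex_of_real (d i) \<cdot>\<^sub>v x - h))"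
    using Qp x h by (intro sum_nonneg) (auto simp: psd_def)
  also have "\<dots> = (\<Sum>i<n. complex_of_real (d i * d i) * q i x x) - (\<Sum>i<n. complex_of_real (d i) * q i x h)
      - (\<Sum>i<n. complex_of_real (d i) * q i h x) + (\<Sum>i<n. complex_of_real 1 * q i h h)"
    by (simp only: Qterm[OF refl] sum.distrib sum_subtractf)
  also have "\<dots> = (\<Phi> (A * A) *\<^sub>v x) \<bullet>c x - (H *\<^sub>v x) \<bullet>c h - (H *\<^sub>v h) \<bullet>c x + h \<bullet>c h"
  proof -
    have "(\<Sum>i<n. complex_of_real (d i * d i) * q i x x) = (\<Phi> (A * A) *\<^sub>v x) \<bullet>c x"
      unfolding Ad spectral_mat_mult[OF U] L[OF x x] ..
    moreover have "(\<Sum>i<n. complex_of_real (d i) * q i x h) = (H *\<^sub>v x) \<bullet>c h"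
      unfolding H_def Ad L[OF x h] ..
    moreover have "(\<Sum>i<n. complex_of_real (d i) * q i h x) = (H *\<^sub>v h) \<bullet>c x"
      unfolding H_def Ad L[OF h x] ..
    moreover have "(\<Sum>i<n. complex_of_real 1 * q i h h) = h \<bullet>c h"
    proof -
      have "spectral_mat n U (\<lambda>_. 1) = 1\<^sub>m n"
        unfolding spectral_mat_const[OF U] by (rule eq_matI) auto
      then show ?thesis using L[OF h h, of "\<lambda>_. 1"] h by (simp add: map_one)
    qed
    ultimately show ?thesis by simp
  qed
  also have "\<dots> = (\<Phi> (A * A) *\<^sub>v x) \<bullet>c x - h \<bullet>c h"
    using hermitian_cscalar_prod[OF H h x] by (simp add: h_def)
  finally show "0 \<le> ((\<Phi> (A * A) - \<Phi> A * \<Phi> A) *\<^sub>v x) \<bullet>c x"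
    unfolding variance_quadratic_form[OF A x] by (simp add: h_def H_def)
qed

text \<open>With \<open>H = \<Phi>(A)\<close> and \<open>P = (M - A)(A - m) \<ge> 0\<close> one has the identity
  \<open>((M - m)/2)\<^sup>2 - (\<Phi>(A\<^sup>2) - H\<^sup>2) = \<Phi>(P) + (H - (M + m)/2)\<^sup>2\<close>, a sum of two positive semidefinite
  matrices; the proof compares quadratic forms.\<close>

theorem variance_bound:
  assumes U: "unitary_mat n U" and A: "A = spectral_mat n U d"
    and d: "\<And>i. i < n \<Longrightarrow> m \<le> d i" "\<And>i. i < n \<Longrightarrow> d i \<le> M"
  shows "psd k (complex_of_real (((M - m) / 2)\<^sup>2) \<cdot>\<^sub>m 1\<^sub>m k - (\<Phi> (A * A) - \<Phi> A * \<Phi> A))"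
  unfolding psd_def
proof (intro conjI ballI)
  note Uc = unitary_matD(1)[OF U]
  have Ac: "A \<in> carrier_mat n n" "hermitian_mat A"
    unfolding A using Uc by (auto simp: hermitian_spectral_mat)
  define S where "S = \<Phi> (A * A) - \<Phi> A * \<Phi> A"
  note S = hermitian_variance[OF Ac, folded S_def]
  let ?c = "complex_of_real (((M - m) / 2)\<^sup>2)"
  show "?c \<cdot>\<^sub>m 1\<^sub>m k - (\<Phi> (A * A) - \<Phi> A * \<Phi> A) \<in> carrier_mat k k"
    unfolding S_def[symmetric] using S by (intro minus_carrier_mat)
  show "hermitian_mat (?c \<cdot>\<^sub>m 1\<^sub>m k - (\<Phi> (A * A) - \<Phi> A * \<Phi> A))"
    unfolding S_def[symmetric]
    by (rule hermitian_mat_minus[OF _ S(1) hermitian_mat_smult_one S(2)]) simp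
  fix x :: "complex vec" assume x: "x \<in> carrier_vec k"
  define H where "H = \<Phi> A"
  define h where "h = H *\<^sub>v x"
  define t where "t = complex_of_real ((M + m) / 2)"
  have H: "H \<in> carrier_mat k k" "hermitian_mat H"
    using Ac map_hermitian[OF Ac] by (auto simp: H_def)
  have h: "h \<in> carrier_vec k" using H x by (auto simp: h_def)
  have AA: "A * A \<in> carrier_mat n n" using Ac by simp
  have AAx: "\<Phi> (A * A) *\<^sub>v x \<in> carrier_vec k"
    using map_carrier[OF AA] x by (rule mult_mat_vec_carrier)
  define P where "P = spectral_mat n U (\<lambda>i. (M - d i) * (d i - m))"
  have P: "P = complex_of_real (M + m) \<cdot>\<^sub>m A - A * A - complex_of_real (M * m) \<cdot>\<^sub>m 1\<^sub>m n"
    unfolding A P_def spectral_mat_mult[OF U] spectral_mat_smult[OF Uc] spectral_mat_minus[OF Uc]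
      spectral_mat_const[OF U, symmetric]
    by (rule spectral_mat_cong) (simp add: algebra_simps)
  have "psd k (\<Phi> P)"
    using d unfolding P_def by (intro map_psd) (auto simp: psd_spectral_mat_iff[OF U])
  then have "0 \<le> (\<Phi> P *\<^sub>v x) \<bullet>c x" using x by (simp add: psd_def)
  moreover have "\<Phi> P = complex_of_real (M + m) \<cdot>\<^sub>m H - \<Phi> (A * A) - complex_of_real (M * m) \<cdot>\<^sub>m 1\<^sub>m k"
    unfolding P H_def using Ac AA
    by (simp add: map_minus map_smult map_one minus_carrier_mat)
  moreover have "(complex_of_real (M + m) \<cdot>\<^sub>m H - \<Phi> (A * A) - complex_of_real (M * m) \<cdot>\<^sub>m 1\<^sub>m k) *\<^sub>v x
      = complex_of_real (M + m) \<cdot>\<^sub>v h - \<Phi> (A * A) *\<^sub>v x - complex_of_real (M * m) \<cdot>\<^sub>v x"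
  proof -
    have "(complex_of_real (M + m) \<cdot>\<^sub>m H) *\<^sub>v x = complex_of_real (M + m) \<cdot>\<^sub>v h"
      unfolding h_def using H x by (intro eq_vecI) auto
    moreover have "(complex_of_real (M * m) \<cdot>\<^sub>m 1\<^sub>m k) *\<^sub>v x = complex_of_real (M * m) \<cdot>\<^sub>v x"
      using x by (intro eq_vecI) auto
    ultimately show ?thesis
      using H x map_carrier[OF AA]
      by (simp add: minus_mult_distrib_mat_vec[of _ k k] minus_carrier_mat[of _ k k])
  qed
  ultimately have "0 \<le> (complex_of_real (M + m) \<cdot>\<^sub>v h - \<Phi> (A * A) *\<^sub>v x - complex_of_real (M * m) \<cdot>\<^sub>v x) \<bullet>c x"
    by (simp only:)
  then have 1: "0 \<le> complex_of_real (M + m) * (h \<bullet>c x) - (\<Phi> (A * A) *\<^sub>v x) \<bullet>c x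
      - complex_of_real (M * m) * (x \<bullet>c x)"
    using x h AAx
    by (simp only: cscalar_prod_minus_left[of _ k] cscalar_prod_smult_left[of _ k]
        smult_carrier_vec minus_carrier_vec)
  have hx: "x \<bullet>c h = h \<bullet>c x" using hermitian_cscalar_prod[OF H x x] by (simp add: h_def)
  have cnj_t: "cnj t = t" by (simp add: t_def)
  have "0 \<le> (h - t \<cdot>\<^sub>v x) \<bullet>c (h - t \<cdot>\<^sub>v x)"
    using h x by (intro conjugate_square_ge_0_vec)
  also have "\<dots> = h \<bullet>c h - t * (h \<bullet>c x) - t * (h \<bullet>c x) + t * t * (x \<bullet>c x)"
    using h x by (simp add: cscalar_prod_minus_left[of _ k] cscalar_prod_minus_right[of _ k]
      cscalar_prod_smult_left[of _ k] cscalar_prod_smult_right[of _ k] hx cnj_t algebra_simps)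
  finally have 2: "0 \<le> h \<bullet>c h - t * (h \<bullet>c x) - t * (h \<bullet>c x) + t * t * (x \<bullet>c x)" .
  have "(?c \<cdot>\<^sub>m 1\<^sub>m k - S) *\<^sub>v x = ?c \<cdot>\<^sub>v x - S *\<^sub>v x"
  proof -
    have "(?c \<cdot>\<^sub>m 1\<^sub>m k) *\<^sub>v x = ?c \<cdot>\<^sub>v x" using x by (intro eq_vecI) auto
    then show ?thesis using S x by (simp add: minus_mult_distrib_mat_vec[of _ k k])
  qed
  then have "((?c \<cdot>\<^sub>m 1\<^sub>m k - S) *\<^sub>v x) \<bullet>c x
      = ?c * (x \<bullet>c x) - ((\<Phi> (A * A) *\<^sub>v x) \<bullet>c x - h \<bullet>c h)"
    using x mult_mat_vec_carrier[OF S(1) x] variance_quadratic_form[OF Ac x]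
    by (simp add: cscalar_prod_minus_left[of _ k] cscalar_prod_smult_left[of _ k] S_def h_def H_def)
  also have "\<dots> = (complex_of_real (M + m) * (h \<bullet>c x) - (\<Phi> (A * A) *\<^sub>v x) \<bullet>c x
      - complex_of_real (M * m) * (x \<bullet>c x))
      + (h \<bullet>c h - t * (h \<bullet>c x) - t * (h \<bullet>c x) + t * t * (x \<bullet>c x))"
    by (simp add: t_def field_simps power2_eq_square)
  finally show "0 \<le> ((?c \<cdot>\<^sub>m 1\<^sub>m k - (\<Phi> (A * A) - \<Phi> A * \<Phi> A)) *\<^sub>v x) \<bullet>c x"
    unfolding S_def using add_nonneg_nonneg[OF 1 2] by simp
qed

end


section \<open>Extreme eigenvalues and the two smallest diagonal entries\<close>

text \<open>Dropping the nonnegative off-diagonal terms leaves a weighted mean of the diagonal entries over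
  the support of \<open>x\<close>, which is at least the smallest of them.\<close>

lemma diagonal_le_form:
  fixes a :: "nat \<Rightarrow> nat \<Rightarrow> real" and x :: "nat \<Rightarrow> real"
  assumes a: "\<And>i j. i < n \<Longrightarrow> j < n \<Longrightarrow> 0 \<le> a i j" and x: "\<And>i. i < n \<Longrightarrow> 0 \<le> x i"
    and ex: "\<exists>i<n. x i \<noteq> 0"
  shows "\<exists>i<n. x i \<noteq> 0 \<and> a i i * (\<Sum>j<n. x j * x j) \<le> (\<Sum>i<n. \<Sum>j<n. a i j * x i * x j)"
proof -
  let ?S = "{i. i < n \<and> x i \<noteq> 0}"
  have "Min ((\<lambda>i. a i i) ` ?S) \<in> (\<lambda>i. a i i) ` ?S"
    using ex by (intro Min_in) auto
  then obtain i where i: "i \<in> ?S" "a i i = Min ((\<lambda>i. a i i) ` ?S)" by auto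
  have min: "a i i \<le> a j j" if "j < n" "x j \<noteq> 0" for j
    unfolding i(2) using that by (intro Min_le) auto
  have "a i i * (\<Sum>j<n. x j * x j) = (\<Sum>j<n. a i i * (x j * x j))"
    by (simp add: sum_distrib_left)
  also have "\<dots> \<le> (\<Sum>j<n. a j j * (x j * x j))"
  proof (intro sum_mono)
    fix j assume "j \<in> {..<n}"
    then show "a i i * (x j * x j) \<le> a j j * (x j * x j)"
      using min[of j] by (cases "x j = 0") (auto intro!: mult_right_mono)
  qed
  also have "\<dots> \<le> (\<Sum>i<n. \<Sum>j<n. a i j * x i * x j)"
  proof (intro sum_mono)
    fix i assume i: "i \<in> {..<n}"
    have "a i i * x i * x i \<le> (\<Sum>j<n. a i j * x i * x j)"
      using i a x by (intro member_le_sum) auto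
    then show "a i i * (x i * x i) \<le> (\<Sum>j<n. a i j * x i * x j)" by (simp add: mult_ac)
  qed
  finally show ?thesis using i(1) by auto
qed

text \<open>The heart of the combinatorial half. The number \<open>R\<close> is any upper bound of the quadratic form, and
  \<open>m\<close> may be any eigenvalue with a real eigenvector \<open>v\<close>. Instead of computing the trace of a compression,
  the proof tests the bound \<open>R\<close> on the vector of the plane spanned by the parts \<open>p\<close>, \<open>q\<close> of \<open>v\<close> that is
  orthogonal to \<open>v\<close>.\<close>

lemma two_diagonal_entries_le_eigenvalue_sum:
  fixes a :: "nat \<Rightarrow> nat \<Rightarrow> real" and v :: "nat \<Rightarrow> real"
  assumes n: "2 \<le> n"
    and nonneg: "\<And>i j. i < n \<Longrightarrow> j < n \<Longrightarrow> 0 \<le> a i j"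
    and sym: "\<And>i j. i < n \<Longrightarrow> j < n \<Longrightarrow> a i j = a j i"
    and R: "\<And>x. (\<Sum>i<n. \<Sum>j<n. a i j * x i * x j) \<le> R * (\<Sum>i<n. x i * x i)"
    and eig: "\<And>i. i < n \<Longrightarrow> (\<Sum>j<n. a i j * v j) = m * v i"
    and v: "\<exists>i<n. v i \<noteq> 0"
  shows "\<exists>i<n. \<exists>j<n. i \<noteq> j \<and> a i i + a j j \<le> R + m"
proof -
  define B where "B = (\<lambda>x y. \<Sum>i<n. \<Sum>j<n. a i j * x i * y j :: real)"
  define N where "N = (\<lambda>x. \<Sum>i<n. x i * x i :: real)"
  define p where "p = (\<lambda>i. max (v i) 0)"
  define q where "q = (\<lambda>i. max (- v i) 0)"
  have p0: "p i \<ge> 0" and q0: "q i \<ge> 0" and vpq: "v i = p i - q i" and pq: "p i * q i = 0" for i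
    by (auto simp: p_def q_def max_def)
  have Bsym: "B x y = B y x" for x y
  proof -
    have "B x y = (\<Sum>j<n. \<Sum>i<n. a i j * x i * y j)" unfolding B_def by (rule sum.swap)
    also have "\<dots> = B y x"
      unfolding B_def by (intro sum.cong refl) (simp add: sym mult_ac)
    finally show ?thesis .
  qed
  have N_eq: "N x = (\<Sum>i<n. x i * x i)" for x by (simp only: N_def)
  have BR: "B x x \<le> R * N x" for x unfolding B_def N_def by (rule R)
  have Beig: "B x p - B x q = m * (\<Sum>i<n. x i * v i)" for x
  proof -
    have "B x p - B x q = (\<Sum>i<n. x i * (\<Sum>j<n. a i j * v j))"
      by (simp add: B_def vpq sum_subtractf[symmetric] sum_distrib_left algebra_simps)
    also have "\<dots> = (\<Sum>i<n. x i * (m * v i))" by (simp add: eig)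
    finally show ?thesis by (simp add: sum_distrib_left mult_ac)
  qed
  have pv: "p i * v i = p i * p i" and qv: "q i * v i = - (q i * q i)" for i
    using pq[of i] by (simp_all add: vpq algebra_simps)
  have Bpp: "B p p = m * N p + B p q"
    using Beig[of p] by (simp add: pv N_def)
  have Bqq: "B q q = m * N q + B p q"
    using Beig[of q] Bsym[of q p] by (simp add: qv N_def sum_negf)
  have Bpq0: "B p q \<ge> 0"
    unfolding B_def using nonneg p0 q0 by (intro sum_nonneg mult_nonneg_nonneg) auto
  have Npos: "N x > 0" if ex: "\<exists>i<n. x i \<noteq> 0" for x
  proof -
    obtain i where "i < n" "x i \<noteq> 0" using ex by blast
    then show ?thesis
      unfolding N_def by (intro sum_pos2[of _ i]) (auto simp: zero_less_mult_iff)
  qed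
  have diagR: "a j j \<le> R" if j: "j < n" for j
    using R[of "\<lambda>i. if i = j then 1 else 0"] j
    by (simp add: if_distrib[of "\<lambda>x. _ * x"] if_distrib[of "\<lambda>x. x * _"] cong: if_cong)
  \<comment> \<open>If an eigenvector has constant sign, its eigenvalue alone dominates a diagonal entry, and
    \<open>R\<close> dominates every other one.\<close>
  have one: "\<exists>i<n. \<exists>j<n. i \<noteq> j \<and> a i i + a j j \<le> R + m"
    if x0: "\<And>i. x i \<ge> 0" and xex: "\<exists>i<n. x i \<noteq> 0" and Bx: "B x x = m * N x" for x
  proof -
    obtain i where i: "i < n" "a i i * N x \<le> B x x"
      using diagonal_le_form[of n a x] nonneg x0 xex unfolding N_def B_def by blast
    then have "a i i \<le> m" using Npos[OF xex] by (simp add: Bx)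
    moreover obtain j where j: "j < n" "j \<noteq> i"
      using n by (metis (full_types) One_nat_def less_2_cases_iff less_le_trans nat_neq_iff zero_neq_one)
    ultimately show ?thesis using i(1) diagR[OF j(1)] by (intro exI[of _ i] exI[of _ j] conjI) auto
  qed
  consider "\<forall>i<n. p i = 0" | "\<forall>i<n. q i = 0" | "\<exists>i<n. p i \<noteq> 0" "\<exists>i<n. q i \<noteq> 0" by blast
  then show ?thesis
  proof cases
    case 1
    then have "B p q = 0" by (simp add: B_def)
    moreover have "\<exists>i<n. q i \<noteq> 0" using v 1 by (auto simp: vpq)
    ultimately show ?thesis using one[of q] q0 Bqq by simp
  next
    case 2
    then have "B p q = 0" by (simp add: B_def)
    moreover have "\<exists>i<n. p i \<noteq> 0" using v 2 by (auto simp: vpq)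
    ultimately show ?thesis using one[of p] p0 Bpp by simp
  next
    case 3
    let ?P = "N p" and ?Q = "N q"
    have pos: "?P > 0" "?Q > 0" using 3 Npos by auto
    obtain i where i: "i < n" "p i \<noteq> 0" "a i i * ?P \<le> B p p"
      using diagonal_le_form[of n a p] nonneg p0 3 unfolding N_def B_def by blast
    obtain j where j: "j < n" "q j \<noteq> 0" "a j j * ?Q \<le> B q q"
      using diagonal_le_form[of n a q] nonneg q0 3 unfolding N_def B_def by blast
    have "i \<noteq> j" using pq[of i] i(2) j(2) by auto
    \<comment> \<open>The weights make \<open>z\<close> orthogonal to \<open>v = p - q\<close>: the inner product is \<open>N q * N p - N p * N q\<close>.\<close>
    define z where "z = (\<lambda>i. ?Q * p i + ?P * q i)"
    have "N z = (\<Sum>i<n. ?Q * ?Q * (p i * p i) + ?P * ?P * (q i * q i))"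
      unfolding N_eq[of z]
    proof (intro sum.cong refl)
      fix i
      have "z i * z i = ?Q * ?Q * (p i * p i) + ?P * ?P * (q i * q i) + 2 * ?P * ?Q * (p i * q i)"
        by (simp add: z_def algebra_simps)
      then show "z i * z i = ?Q * ?Q * (p i * p i) + ?P * ?P * (q i * q i)" by (simp add: pq)
    qed
    then have Nz: "N z = ?P * ?Q * (?P + ?Q)"
      by (simp add: sum.distrib sum_distrib_left[symmetric] N_eq[symmetric] algebra_simps)
    have "B z z = ?Q * ?Q * B p p + ?P * ?Q * B p q + ?P * ?Q * B q p + ?P * ?P * B q q"
      unfolding B_def z_def by (simp add: sum.distrib sum_distrib_left algebra_simps)
    then have Bz: "B z z = m * (?P * ?Q * (?P + ?Q)) + B p q * ((?P + ?Q) * (?P + ?Q))"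
      unfolding Bsym[of q p] Bpp Bqq by (simp add: algebra_simps)
    have "B p q * (?P + ?Q) * (?P + ?Q) \<le> (R - m) * (?P * ?Q) * (?P + ?Q)"
      using BR[of z] unfolding Nz Bz by (simp add: algebra_simps)
    then have 1: "B p q * (?P + ?Q) \<le> (R - m) * (?P * ?Q)"
      using pos by (simp add: mult_le_cancel_right)
    have "a i i * ?P * ?Q \<le> (m * ?P + B p q) * ?Q" "a j j * ?Q * ?P \<le> (m * ?Q + B p q) * ?P"
      using i(3) j(3) pos unfolding Bpp Bqq by (auto intro!: mult_right_mono)
    with 1 have "(a i i + a j j) * (?P * ?Q) \<le> (R + m) * (?P * ?Q)"
      by (simp add: algebra_simps)
    then have "a i i + a j j \<le> R + m" using pos by (simp add: mult_le_cancel_right)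
    then show ?thesis using i(1) j(1) \<open>i \<noteq> j\<close> by blast
  qed
qed

text \<open>Sorting moves \<open>i\<close> and \<open>j\<close> to distinct positions, so at least one of these is not the first.\<close>

lemma two_smallest_le:
  fixes xs :: "real list"
  assumes "i < length xs" "j < length xs" "i \<noteq> j"
  shows "sort xs ! 0 + sort xs ! 1 \<le> xs ! i + xs ! j"
proof -
  obtain f where f: "bij_betw f {..<length xs} {..<length (sort xs)}"
      "\<forall>i<length xs. xs ! i = sort xs ! f i"
    using permutation_Ex_bij[of xs "sort xs"] by auto
  have fl: "f i < length xs" "f j < length xs" using f(1) assms by (auto simp: bij_betw_def)
  have ne: "f i \<noteq> f j" using f(1) assms by (auto simp: bij_betw_def inj_on_def)
  have mono: "sort xs ! a \<le> sort xs ! b" if "a \<le> b" "b < length xs" for a b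
    using that by (intro sorted_nth_mono) auto
  consider "f i \<ge> 1" | "f j \<ge> 1" using ne by linarith
  then show ?thesis
  proof cases
    case 1
    then show ?thesis using mono[of 1 "f i"] mono[of 0 "f j"] fl f(2) assms by auto
  next
    case 2
    then show ?thesis using mono[of 1 "f j"] mono[of 0 "f i"] fl f(2) assms by auto
  qed
qed

lemma spectral_mat_le_spectral_radius:
  assumes U: "unitary_mat n U" and i: "i < n"
  shows "\<bar>d i\<bar> \<le> spectral_radius (spectral_mat n U d)"
proof -
  note Uc = unitary_matD(1)[OF U]
  let ?A = "spectral_mat n U d"
  have A: "?A \<in> carrier_mat n n" using Uc by simp
  note u = unitary_mat_col_norm[OF U i]
  have "col U i \<noteq> 0\<^sub>v n" using u by auto
  then have "eigenvalue ?A (complex_of_real (d i))"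
    unfolding eigenvalue_def eigenvector_def
    using u A spectral_mat_mult_col[OF U i, of d] by (intro exI[of _ "col U i"]) auto
  then have "\<bar>d i\<bar> \<in> norm ` spectrum ?A"
    by (intro image_eqI[of _ _ "complex_of_real (d i)"]) (auto simp: spectrum_def)
  then show ?thesis using spectral_radius_mem_max(2)[OF A] i by auto
qed

text \<open>The passage from the complex matrix to the real lemma: \<open>A\<close> has real entries, so the real and
  imaginary parts of a complex eigenvector satisfy the same eigenvalue equation, and one of them is
  nonzero.\<close>

lemma two_smallest_diagonal_entries_le:
  assumes n: "2 \<le> n" and A: "A \<in> carrier_mat n n" and nonneg: "nonneg_mat A"
    and sym: "transpose_mat A = A" and U: "unitary_mat n U" and Ad: "A = spectral_mat n U d"
    and M: "\<And>i. i < n \<Longrightarrow> d i \<le> M" and l: "l < n"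
  shows "sorted_diag A ! 0 + sorted_diag A ! 1 \<le> M + d l"
proof -
  note Uc = unitary_matD(1)[OF U]
  define a where "a = (\<lambda>i j. Re (A $$ (i, j)))"
  have Aa: "A $$ (i, j) = complex_of_real (a i j)" and a0: "0 \<le> a i j" if "i < n" "j < n" for i j
    using nonneg that A by (auto simp: nonneg_mat_def less_eq_complex_def a_def complex_eq_iff)
  have asym: "a i j = a j i" if "i < n" "j < n" for i j
    using index_transpose_mat(1)[of i A j] that A by (simp add: sym a_def)
  have form: "(\<Sum>i<n. \<Sum>j<n. a i j * x i * x j) \<le> M * (\<Sum>i<n. x i * x i)" for x :: "nat \<Rightarrow> real"
  proof -
    define X where "X = vec n (\<lambda>i. complex_of_real (x i))"
    have X: "X \<in> carrier_vec n" by (simp add: X_def)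
    have psd: "psd n (complex_of_real M \<cdot>\<^sub>m 1\<^sub>m n - A)"
      unfolding Ad spectral_mat_const[OF U, symmetric] spectral_mat_minus[OF Uc]
      using M by (simp add: psd_spectral_mat_iff[OF U])
    have "(complex_of_real M \<cdot>\<^sub>m 1\<^sub>m n) *\<^sub>v X = complex_of_real M \<cdot>\<^sub>v X"
      using X by (intro eq_vecI) auto
    then have "((complex_of_real M \<cdot>\<^sub>m 1\<^sub>m n - A) *\<^sub>v X) \<bullet>c X
        = complex_of_real M * (X \<bullet>c X) - (A *\<^sub>v X) \<bullet>c X"
      using X A by (simp add: minus_mult_distrib_mat_vec[of _ n n] cscalar_prod_minus_left[of _ n]
          cscalar_prod_smult_left[of _ n] mult_mat_vec_carrier[of _ n n])
    also have "X \<bullet>c X = complex_of_real (\<Sum>i<n. x i * x i)"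
      using X by (simp add: cscalar_prod_sum[of _ n]) (simp add: X_def)
    also have "(A *\<^sub>v X) \<bullet>c X = complex_of_real (\<Sum>i<n. \<Sum>j<n. a i j * x i * x j)"
    proof -
      have AX: "(A *\<^sub>v X) $ i = complex_of_real (\<Sum>j<n. a i j * x j)" if "i < n" for i
        using A that by (auto simp: scalar_prod_def lessThan_atLeast0 X_def Aa intro!: sum.cong)
      have "(A *\<^sub>v X) \<bullet>c X = (\<Sum>i<n. (A *\<^sub>v X) $ i * cnj (X $ i))"
        using A X by (intro cscalar_prod_sum) auto
      also have "\<dots> = (\<Sum>i<n. complex_of_real ((\<Sum>j<n. a i j * x j) * x i))"
      proof (intro sum.cong refl)
        fix i assume "i \<in> {..<n}"
        moreover from this have "X $ i = complex_of_real (x i)" by (simp add: X_def)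
        ultimately show "(A *\<^sub>v X) $ i * cnj (X $ i) = complex_of_real ((\<Sum>j<n. a i j * x j) * x i)"
          using AX[of i] by simp
      qed
      finally show ?thesis by (simp add: sum_distrib_left mult_ac)
    qed
    finally have eq: "((complex_of_real M \<cdot>\<^sub>m 1\<^sub>m n - A) *\<^sub>v X) \<bullet>c X
        = complex_of_real M * complex_of_real (\<Sum>i<n. x i * x i)
          - complex_of_real (\<Sum>i<n. \<Sum>j<n. a i j * x i * x j)" .
    have "0 \<le> ((complex_of_real M \<cdot>\<^sub>m 1\<^sub>m n - A) *\<^sub>v X) \<bullet>c X"
      using psd X unfolding psd_def by blast
    then have "0 \<le> complex_of_real M * complex_of_real (\<Sum>i<n. x i * x i)
        - complex_of_real (\<Sum>i<n. \<Sum>j<n. a i j * x i * x j)"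
      unfolding eq .
    then show ?thesis
      by (simp add: less_eq_complex_def del: of_real_sum)
  qed
  define u where "u = col U l"
  note u = unitary_mat_col_norm[OF U l, folded u_def]
  have eig: "(\<Sum>j<n. complex_of_real (a i j) * u $ j) = complex_of_real (d l) * u $ i" if "i < n" for i
  proof -
    have "(A *\<^sub>v u) $ i = complex_of_real (d l) * u $ i"
      using spectral_mat_mult_col[OF U l, of d] u that by (simp add: Ad u_def[symmetric])
    moreover have "(A *\<^sub>v u) $ i = (\<Sum>j<n. complex_of_real (a i j) * u $ j)"
      using A u that by (auto simp: scalar_prod_def lessThan_atLeast0 Aa intro!: sum.cong)
    ultimately show ?thesis by simp
  qed
  have "\<exists>v. (\<forall>i<n. (\<Sum>j<n. a i j * v j) = d l * v i) \<and> (\<exists>i<n. v i \<noteq> 0)"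
  proof -
    have re: "(\<Sum>j<n. a i j * Re (u $ j)) = d l * Re (u $ i)"
      and im: "(\<Sum>j<n. a i j * Im (u $ j)) = d l * Im (u $ i)" if "i < n" for i
      using arg_cong[OF eig[OF that], of Re] arg_cong[OF eig[OF that], of Im] by simp_all
    have "u \<noteq> 0\<^sub>v n" using u by auto
    moreover have "u = 0\<^sub>v n" if "\<forall>i<n. u $ i = 0" using u(1) that by (intro eq_vecI) auto
    ultimately obtain i where "i < n" "u $ i \<noteq> 0" by blast
    then have "Re (u $ i) \<noteq> 0 \<or> Im (u $ i) \<noteq> 0" by (simp add: complex_eq_iff)
    then show ?thesis
    proof
      assume "Re (u $ i) \<noteq> 0"
      with re \<open>i < n\<close> show ?thesis by (intro exI[of _ "\<lambda>j. Re (u $ j)"]) blast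
    next
      assume "Im (u $ i) \<noteq> 0"
      with im \<open>i < n\<close> show ?thesis by (intro exI[of _ "\<lambda>j. Im (u $ j)"]) blast
    qed
  qed
  then obtain v where "\<And>i. i < n \<Longrightarrow> (\<Sum>j<n. a i j * v j) = d l * v i" "\<exists>i<n. v i \<noteq> 0" by blast
  from two_diagonal_entries_le_eigenvalue_sum[of n a M v "d l", OF n a0 asym form this]
  obtain i j where ij: "i < n" "j < n" "i \<noteq> j" "a i i + a j j \<le> M + d l" by blast
  have "sorted_diag A ! 0 + sorted_diag A ! 1 \<le> map Re (diag_mat A) ! i + map Re (diag_mat A) ! j"
    unfolding sorted_diag_def using ij A by (intro two_smallest_le) (auto simp: diag_mat_def)
  also have "\<dots> = a i i + a j j" using ij A by (simp add: diag_mat_def a_def)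
  finally show ?thesis using ij(4) by simp
qed

theorem theorem2p1:
  fixes n k :: nat and \<Phi> :: "complex mat \<Rightarrow> complex mat" and A :: "complex mat"
    and b11 b22 :: real
  assumes "n \<ge> 2" and "k \<ge> 1"
    and "linear_map class_ring (module_mat TYPE(complex) n n) (module_mat TYPE(complex) k k) \<Phi>"
    and "positive_mat_map n k \<Phi>" and "unital_mat_map n k \<Phi>"
    and "A \<in> carrier_mat n n" and "nonneg_mat A" and "transpose_mat A = A"
    and "b11 = sorted_diag A ! 0" and "b22 = sorted_diag A ! 1"
  shows "loewner_ge k
    (complex_of_real (spectral_radius A) \<cdot>\<^sub>m 1\<^sub>m k)
    (complex_of_real ((b11 + b22) / 2) \<cdot>\<^sub>m 1\<^sub>m k
      + psd_sqrt k (\<Phi> (A ^\<^sub>m 2) - (\<Phi> A) ^\<^sub>m 2))"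
proof -
  interpret positive_unital_map n k \<Phi>
    by (rule positive_unital_map.intro[OF assms(3-5)])
  note A = \<open>A \<in> carrier_mat n n\<close>
  have herm: "hermitian_mat A"
    unfolding hermitian_mat_def
  proof (rule eq_matI)
    fix i j assume "i < dim_row A" "j < dim_col A"
    then have ij: "i < n" "j < n" using A by auto
    have "A $$ (j, i) = transpose_mat A $$ (i, j)" using A ij by simp
    then have "A $$ (j, i) = A $$ (i, j)" by (simp only: \<open>transpose_mat A = A\<close>)
    moreover have "cnj (A $$ (i, j)) = A $$ (i, j)"
      using A ij \<open>nonneg_mat A\<close> by (auto simp: nonneg_mat_def less_eq_complex_def complex_eq_iff)
    ultimately show "mat_adjoint A $$ (i, j) = A $$ (i, j)" using A ij by simp
  qed (use A in auto)
  obtain U d where U: "unitary_mat n U" and Ad: "A = spectral_mat n U d"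
    using spectral_theorem[OF A herm] by blast
  define \<rho> where "\<rho> = spectral_radius A"
  define m where "m = Min (d ` {..<n})"
  have \<rho>: "d i \<le> \<rho>" if "i < n" for i
    using spectral_mat_le_spectral_radius[OF U that, of d] by (simp add: \<rho>_def Ad)
  have m: "m \<le> d i" if "i < n" for i
    unfolding m_def using that by (intro Min_le) auto
  have "{..<n} \<noteq> {}" using \<open>n \<ge> 2\<close> by (auto simp: lessThan_empty_iff)
  then have "m \<in> d ` {..<n}" unfolding m_def by (intro Min_in) auto
  then obtain l where l: "l < n" "m = d l" by auto
  have sum: "b11 + b22 \<le> \<rho> + m"
    using two_smallest_diagonal_entries_le[OF \<open>n \<ge> 2\<close> A assms(7,8) U Ad \<rho> l(1)] assms(9,10) l(2)
    by simp
  define S where "S = \<Phi> (A * A) - \<Phi> A * \<Phi> A"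
  have S_eq: "\<Phi> (A ^\<^sub>m 2) - (\<Phi> A) ^\<^sub>m 2 = S"
    using pow_mat_two[OF A] pow_mat_two[OF map_carrier[OF A]] by (simp add: S_def)
  have S: "psd k S" unfolding S_def by (rule kadison_inequality[OF A herm])
  then obtain V s where V: "unitary_mat k V" and Ss: "S = spectral_mat k V s"
    using spectral_theorem[of S k] by (auto simp: psd_def)
  note Vc = unitary_matD(1)[OF V]
  have s0: "0 \<le> s i" if "i < k" for i
    using S that by (simp add: Ss psd_spectral_mat_iff[OF V])
  have "psd k (complex_of_real (((\<rho> - m) / 2)\<^sup>2) \<cdot>\<^sub>m 1\<^sub>m k - S)"
    unfolding S_def by (rule variance_bound[OF U Ad m \<rho>])
  then have "s i \<le> ((\<rho> - m) / 2)\<^sup>2" if "i < k" for i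
    using that
    unfolding Ss spectral_mat_const[OF V, symmetric] spectral_mat_minus[OF Vc] psd_spectral_mat_iff[OF V]
    by auto
  moreover have "0 \<le> (\<rho> - m) / 2" using \<rho>[OF l(1)] l(2) by simp
  ultimately have sqrt_le: "sqrt (s i) \<le> (\<rho> - m) / 2" if "i < k" for i
    using that by (intro real_le_lsqrt) auto
  let ?\<beta> = "(b11 + b22) / 2"
  have Q: "complex_of_real ?\<beta> \<cdot>\<^sub>m 1\<^sub>m k + psd_sqrt k S = spectral_mat k V (\<lambda>i. ?\<beta> + sqrt (s i))"
  proof -
    have "psd_sqrt k S = spectral_mat k V (\<lambda>i. sqrt (s i))"
      unfolding Ss using V s0 by (rule psd_sqrt_spectral_mat)
    then show ?thesis
      by (simp only: spectral_mat_const[OF V, symmetric] spectral_mat_add[OF Vc])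
  qed
  have "psd k (spectral_mat k V (\<lambda>i. \<rho> - (?\<beta> + sqrt (s i))))"
    unfolding psd_spectral_mat_iff[OF V]
  proof (intro allI impI)
    fix i assume "i < k"
    then show "0 \<le> \<rho> - (?\<beta> + sqrt (s i))" using sqrt_le[of i] sum by (simp add: field_simps)
  qed
  then show ?thesis
    unfolding S_eq Q unfolding \<rho>_def[symmetric] spectral_mat_const[OF V, symmetric] loewner_ge_def
    using Vc by (simp add: hermitian_spectral_mat spectral_mat_minus)
qed

end
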